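(* Let $((A,\circ),P)$ be an $S$-admissible averaging pre-Lie algebra, where $S:A\to A$ is a linear map, and let $r\in A\otimes A$. Define $\Delta_r:A\to A\otimes A$ by $\Delta_r(x)=(L_x\otimes\mathrm{id}+\mathrm{id}\otimes(L_x-R_x))r$. If $r$ is a symmetric solution of the $S$-admissible classical Yang-Baxter equation in $((A,\circ),P)$, then $(A,\circ,\Delta_r,P,S)$ is an averaging pre-Lie bialgebra.
   Context: All vector spaces are finite-dimensional over a fixed field $\mathbf k$ of characteristic $0$; $\tau(x\otimes y)=y\otimes x$; $r$ is symmetric if $\tau(r)=r$. A pre-Lie algebra $(A,\circ)$ is a vector space with a bilinear product satisfying $(x\circ y)\circ z-x\circ(y\circ z)=(y\circ x)\circ z-y\circ(x\circ z)$. Write $L_xy=x\circ y$, $R_xy=y\circ x$. An averaging operator is a linear $P:A\to A$ with $P(x)\circ P(y)=P(P(x)\circ y)=P(x\circ P(y))$; then $((A,\circ),P)$ is an averaging pre-Lie algebra. It is $S$-admissible if for all $x,y\in A$: $P(x)\circ S(y)=S(P(x)\circ y)=S(x\circ S(y))$ and $S(x)\circ P(y)=S(x\circ P(y))=S(S(x)\circ y)$. An element $r=\sum_ia_i\otimes b_i\in A\otimes A$ is a solution of the $S$-admissible classical Yang-Baxter equation in $((A,\circ),P)$ if $\sum_{i,j}\bigl(a_i\otimes b_i\circ a_j\otimes b_j+a_i\otimes a_j\otimes b_i\circ b_j\bigr)=\sum_{i,j}\bigl(a_i\circ a_j\otimes b_i\otimes b_j+a_i\otimes a_j\otimes b_j\circ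 b_i\bigr)$, $(S\otimes\mathrm{id}-\mathrm{id}\otimes P)(r)=0$, and $(P\otimes\mathrm{id}-\mathrm{id}\otimes S)(r)=0$. A pre-Lie coalgebra $(A,\Delta)$ satisfies $(\Delta\otimes\mathrm{id})\Delta-(\mathrm{id}\otimes\Delta)\Delta=(\tau\otimes\mathrm{id})\bigl((\Delta\otimes\mathrm{id})\Delta-(\mathrm{id}\otimes\Delta)\Delta\bigr)$. A pre-Lie bialgebra $(A,\circ,\Delta)$ is a pre-Lie algebra and pre-Lie coalgebra such that for all $x,y$: $\Delta(x\circ y-y\circ x)=(L_x\otimes\mathrm{id}+\mathrm{id}\otimes(L_x-R_x))\Delta(y)-(L_y\otimes\mathrm{id}+\mathrm{id}\otimes(L_y-R_y))\Delta(x)$ and $(\mathrm{id}-\tau)\Delta(x\circ y)=(\mathrm{id}-\tau)\bigl[(\mathrm{id}\otimes R_y)\Delta(x)+(L_x\otimes\mathrm{id}+\mathrm{id}\otimes L_x)\Delta(y)\bigr]$. An averaging pre-Lie coalgebra $((A,\Delta),S)$ is a pre-Lie coalgebra with linear $S:A\to A$ such that $(S\otimes S)\Delta(x)=(S\otimes\mathrm{id})\Delta(S(x))=(\mathrm{id}\otimes S)\Delta(S(x))$. An averaging pre-Lie bialgebra is a quintuple $(A,\circ,\Delta,P,S)$ such that $((A,\circ),P)$ is an $S$-admissible averaging pre-Lie algebra, $((A,\Delta),S)$ is an averaging pre-Lie coalgebra, $(A,\circ,\Delta)$ is a pre-Lie bialgebra, and for all $x\in A$: $(P\otimes S)\Delta(x)=(\mathrm{id}\otimes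 S)\Delta(P(x))=(P\otimes\mathrm{id})\Delta(P(x))$; $(S\otimes P)\Delta(x)=(S\otimes\mathrm{id})\Delta(P(x))=(\mathrm{id}\otimes P)\Delta(P(x))$. *)

theory Defs
  imports Complex_Main "HOL-Library.Function_Algebras"
begin

section \<open>Tensor squares and cubes of a vector space\<close>

definition bilinear_map ::
    "('k::field \<Rightarrow> 'a::ab_group_add \<Rightarrow> 'a) \<Rightarrow> ('k \<Rightarrow> 'b::ab_group_add \<Rightarrow> 'b)
      \<Rightarrow> ('k \<Rightarrow> 'c::ab_group_add \<Rightarrow> 'c) \<Rightarrow> ('a \<Rightarrow> 'b \<Rightarrow> 'c) \<Rightarrow> bool" where
  "bilinear_map s1 s2 s3 f \<longleftrightarrow>
     (\<forall>x. Vector_Spaces.linear s2 s3 (f x)) \<and> (\<forall>y. Vector_Spaces.linear s1 s3 (\<lambda>x. f x y))"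

definition bilinear_form ::
    "('k::field \<Rightarrow> 'a::ab_group_add \<Rightarrow> 'a) \<Rightarrow> ('a \<Rightarrow> 'a \<Rightarrow> 'k) \<Rightarrow> bool" where
  "bilinear_form s w \<longleftrightarrow> bilinear_map s s (*) w"

definition trilinear_map ::
    "('k::field \<Rightarrow> 'a::ab_group_add \<Rightarrow> 'a) \<Rightarrow> ('k \<Rightarrow> 'c::ab_group_add \<Rightarrow> 'c)
      \<Rightarrow> ('a \<Rightarrow> 'a \<Rightarrow> 'a \<Rightarrow> 'c) \<Rightarrow> bool" where
  "trilinear_map s s' f \<longleftrightarrow>
     (\<forall>x y. Vector_Spaces.linear s s' (f x y)) \<and>
     (\<forall>x z. Vector_Spaces.linear s s' (\<lambda>y. f x y z)) \<and>
     (\<forall>y z. Vector_Spaces.linear s s' (\<lambda>x. f x y z))"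

definition trilinear_form ::
    "('k::field \<Rightarrow> 'a::ab_group_add \<Rightarrow> 'a) \<Rightarrow> ('a \<Rightarrow> 'a \<Rightarrow> 'a \<Rightarrow> 'k) \<Rightarrow> bool" where
  "trilinear_form s w \<longleftrightarrow> trilinear_map s (*) w"

text \<open>
  Since a type cannot depend on the scalar multiplication \<open>s\<close>, the space \<open>A \<otimes> A\<close> is realised
  inside a fixed function space: \<open>x \<otimes> y\<close> is the functional that evaluates a bilinear form at
  \<open>(x, y)\<close> (with value 0 on functions that are not bilinear forms), and \<open>A \<otimes> A\<close> is the set of
  finite sums of such functionals. Likewise for \<open>A \<otimes> A \<otimes> A\<close> and trilinear forms. That this is the
  tensor product is the content of the bilinearity lemmas together with the universal property
  \<open>tensor_lift\<close>, \<open>tensor3_lift\<close> below. Addition, subtraction and zero of tensors, and of maps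
  between tensor spaces, are the pointwise ones of \<^theory>\<open>HOL-Library.Function_Algebras\<close>.
\<close>

type_synonym ('a, 'k) tensor2 = "('a \<Rightarrow> 'a \<Rightarrow> 'k) \<Rightarrow> 'k"
type_synonym ('a, 'k) tensor3 = "('a \<Rightarrow> 'a \<Rightarrow> 'a \<Rightarrow> 'k) \<Rightarrow> 'k"

definition tensor ::
    "'a::ab_group_add \<Rightarrow> ('k::field \<Rightarrow> 'a \<Rightarrow> 'a) \<Rightarrow> 'a \<Rightarrow> ('a, 'k) tensor2"
    ("(_ \<otimes>\<^bsub>_\<^esub> _)" [71, 0, 71] 70) where
  "x \<otimes>\<^bsub>s\<^esub> y = (\<lambda>w. if bilinear_form s w then w x y else 0)"

definition triple_tensor ::
    "('k::field \<Rightarrow> 'a::ab_group_add \<Rightarrow> 'a) \<Rightarrow> 'a \<Rightarrow> 'a \<Rightarrow> 'a \<Rightarrow> ('a, 'k) tensor3" where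
  "triple_tensor s x y z = (\<lambda>w. if trilinear_form s w then w x y z else 0)"

definition tensor_square ::
    "('k::field \<Rightarrow> 'a::ab_group_add \<Rightarrow> 'a) \<Rightarrow> ('a, 'k) tensor2 set" where
  "tensor_square s = {\<Sum>i<n. a i \<otimes>\<^bsub>s\<^esub> b i | (n::nat) a b. True}"

definition tensor_scale :: "'k::field \<Rightarrow> ('w \<Rightarrow> 'k) \<Rightarrow> ('w \<Rightarrow> 'k)" where
  "tensor_scale c t = (\<lambda>w. c * t w)"

text \<open>
  Maps out of a tensor space are given by transposition; their effect on
  pure tensors is recorded in the lemmas below.
\<close>

text \<open>\<open>f \<otimes> g : A \<otimes> A \<rightarrow> A \<otimes> A\<close> for linear maps \<open>f\<close>, \<open>g\<close>\<close>
definition tensor_map ::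
    "('k::field \<Rightarrow> 'a::ab_group_add \<Rightarrow> 'a) \<Rightarrow> ('a \<Rightarrow> 'a) \<Rightarrow> ('a \<Rightarrow> 'a)
      \<Rightarrow> ('a, 'k) tensor2 \<Rightarrow> ('a, 'k) tensor2" where
  "tensor_map s f g t = (\<lambda>w. if bilinear_form s w then t (\<lambda>x y. w (f x) (g y)) else 0)"

text \<open>\<open>\<tau> : A \<otimes> A \<rightarrow> A \<otimes> A\<close>\<close>
definition twist :: "('a, 'k) tensor2 \<Rightarrow> ('a, 'k) tensor2" where
  "twist t = (\<lambda>w. t (\<lambda>x y. w y x))"

text \<open>\<open>\<tau> \<otimes> id : A \<otimes> A \<otimes> A \<rightarrow> A \<otimes> A \<otimes> A\<close>\<close>
definition twist_id :: "('a, 'k) tensor3 \<Rightarrow> ('a, 'k) tensor3" where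
  "twist_id t = (\<lambda>w. t (\<lambda>x y z. w y x z))"

text \<open>\<open>\<Delta> \<otimes> id\<close> and \<open>id \<otimes> \<Delta> : A \<otimes> A \<rightarrow> A \<otimes> A \<otimes> A\<close> for a linear map \<open>\<Delta> : A \<rightarrow> A \<otimes> A\<close>\<close>
definition comult_id ::
    "('k::field \<Rightarrow> 'a::ab_group_add \<Rightarrow> 'a) \<Rightarrow> ('a \<Rightarrow> ('a, 'k) tensor2)
      \<Rightarrow> ('a, 'k) tensor2 \<Rightarrow> ('a, 'k) tensor3" where
  "comult_id s \<Delta> t =
     (\<lambda>w. if trilinear_form s w then t (\<lambda>x y. \<Delta> x (\<lambda>u v. w u v y)) else 0)"

definition id_comult ::
    "('k::field \<Rightarrow> 'a::ab_group_add \<Rightarrow> 'a) \<Rightarrow> ('a \<Rightarrow> ('a, 'k) tensor2)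
      \<Rightarrow> ('a, 'k) tensor2 \<Rightarrow> ('a, 'k) tensor3" where
  "id_comult s \<Delta> t =
     (\<lambda>w. if trilinear_form s w then t (\<lambda>x y. \<Delta> y (\<lambda>u v. w x u v)) else 0)"


subsection \<open>Bilinearity, universal property, and maps on pure tensors\<close>

lemma sum_fun_apply: "(\<Sum>i\<in>I. f i) x = (\<Sum>i\<in>I. (f i x :: 'b::comm_monoid_add))"
  by (induction I rule: infinite_finite_induct) auto

lemma vector_space_field: "vector_space ((*) :: 'k::field \<Rightarrow> 'k \<Rightarrow> 'k)"
  by unfold_locales (auto simp: algebra_simps)

lemma vector_space_tensor_scale: "vector_space (tensor_scale :: 'k::field \<Rightarrow> ('w \<Rightarrow> 'k) \<Rightarrow> _)"
  by unfold_locales (auto simp: tensor_scale_def algebra_simps fun_eq_iff)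

lemma bilinear_map_tensor:
  assumes "vector_space s"
  shows "bilinear_map s s tensor_scale (\<lambda>x y. x \<otimes>\<^bsub>s\<^esub> y)"
  using assms vector_space_tensor_scale
  by (auto simp: bilinear_map_def bilinear_form_def Vector_Spaces.linear_iff tensor_def
      tensor_scale_def fun_eq_iff)

lemma trilinear_map_triple_tensor:
  assumes "vector_space s"
  shows "trilinear_map s tensor_scale (triple_tensor s)"
  using assms vector_space_tensor_scale
  by (auto simp: trilinear_map_def trilinear_form_def Vector_Spaces.linear_iff triple_tensor_def
      tensor_scale_def fun_eq_iff)

lemma separating_functional:
  fixes s :: "'k::field \<Rightarrow> 'c::ab_group_add \<Rightarrow> 'c"
  assumes "vector_space s" "v \<noteq> 0"
  obtains \<phi> where "Vector_Spaces.linear s ((*) :: 'k \<Rightarrow> 'k \<Rightarrow> 'k) \<phi>" "\<phi> v \<noteq> 0"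
proof -
  interpret vector_space_pair s "(*) :: 'k \<Rightarrow> 'k \<Rightarrow> 'k"
    using assms(1) vector_space_field by (rule vector_space_pair.intro)
  have "vs1.independent {v}"
    using assms(2) by simp
  from linear_independent_extend[OF this, of "\<lambda>_. 1"] that show thesis
    by auto
qed

text \<open>A bilinear map induces a well-defined map on \<open>A \<otimes> A\<close>, for any target space.\<close>
lemma tensor_lift:
  fixes s' :: "'k::field \<Rightarrow> 'c::ab_group_add \<Rightarrow> 'c"
  assumes "bilinear_map s s s' f"
    and eq: "(\<Sum>i<n. a i \<otimes>\<^bsub>s\<^esub> b i) = (\<Sum>j<m. c j \<otimes>\<^bsub>s\<^esub> d j)"
  shows "(\<Sum>i<n. f (a i) (b i)) = (\<Sum>j<m. f (c j) (d j))"
proof (rule ccontr)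
  assume ne: "\<not> ?thesis"
  have vs: "vector_space s'"
    using assms(1) by (auto simp: bilinear_map_def Vector_Spaces.linear_iff)
  from ne have "(\<Sum>i<n. f (a i) (b i)) - (\<Sum>j<m. f (c j) (d j)) \<noteq> 0" (is "?l - ?r \<noteq> 0")
    by simp
  from separating_functional[OF vs this] obtain \<phi>
    where \<phi>: "Vector_Spaces.linear s' ((*) :: 'k \<Rightarrow> 'k \<Rightarrow> 'k) \<phi>" "\<phi> (?l - ?r) \<noteq> 0" .
  interpret \<phi>: Vector_Spaces.linear s' "(*) :: 'k \<Rightarrow> 'k \<Rightarrow> 'k" \<phi> by (rule \<phi>(1))
  have bil: "bilinear_form s (\<lambda>x y. \<phi> (f x y))"
    using assms(1) \<phi>(1) by (auto simp: bilinear_form_def bilinear_map_def Vector_Spaces.linear_iff)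
  have "(\<Sum>i<n. a i \<otimes>\<^bsub>s\<^esub> b i) (\<lambda>x y. \<phi> (f x y)) = (\<Sum>j<m. c j \<otimes>\<^bsub>s\<^esub> d j) (\<lambda>x y. \<phi> (f x y))"
    by (simp add: eq)
  then have "\<phi> ?l = \<phi> ?r"
    using bil by (simp add: sum_fun_apply tensor_def \<phi>.sum)
  with \<phi>(2) show False
    by (simp add: \<phi>.diff)
qed

lemma tensor3_lift:
  fixes s' :: "'k::field \<Rightarrow> 'c::ab_group_add \<Rightarrow> 'c"
  assumes "trilinear_map s s' f"
    and eq: "(\<Sum>i<n. triple_tensor s (a i) (b i) (c i)) = (\<Sum>j<m. triple_tensor s (a' j) (b' j) (c' j))"
  shows "(\<Sum>i<n. f (a i) (b i) (c i)) = (\<Sum>j<m. f (a' j) (b' j) (c' j))"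
proof (rule ccontr)
  assume ne: "\<not> ?thesis"
  have vs: "vector_space s'"
    using assms(1) by (auto simp: trilinear_map_def Vector_Spaces.linear_iff)
  from ne have "(\<Sum>i<n. f (a i) (b i) (c i)) - (\<Sum>j<m. f (a' j) (b' j) (c' j)) \<noteq> 0"
    (is "?l - ?r \<noteq> 0")
    by simp
  from separating_functional[OF vs this] obtain \<phi>
    where \<phi>: "Vector_Spaces.linear s' ((*) :: 'k \<Rightarrow> 'k \<Rightarrow> 'k) \<phi>" "\<phi> (?l - ?r) \<noteq> 0" .
  interpret \<phi>: Vector_Spaces.linear s' "(*) :: 'k \<Rightarrow> 'k \<Rightarrow> 'k" \<phi> by (rule \<phi>(1))
  have tri: "trilinear_form s (\<lambda>x y z. \<phi> (f x y z))"
    using assms(1) \<phi>(1)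
    by (auto simp: trilinear_form_def trilinear_map_def Vector_Spaces.linear_iff)
  have "(\<Sum>i<n. triple_tensor s (a i) (b i) (c i)) (\<lambda>x y z. \<phi> (f x y z))
      = (\<Sum>j<m. triple_tensor s (a' j) (b' j) (c' j)) (\<lambda>x y z. \<phi> (f x y z))"
    by (simp add: eq)
  then have "\<phi> ?l = \<phi> ?r"
    using tri by (simp add: sum_fun_apply triple_tensor_def \<phi>.sum)
  with \<phi>(2) show False
    by (simp add: \<phi>.diff)
qed

lemma tensor_map_tensor:
  assumes "Vector_Spaces.linear s s f" "Vector_Spaces.linear s s g"
  shows "tensor_map s f g (x \<otimes>\<^bsub>s\<^esub> y) = f x \<otimes>\<^bsub>s\<^esub> g y"
proof -
  have "bilinear_form s (\<lambda>x y. w (f x) (g y))" if "bilinear_form s w" for w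
    using that assms by (auto simp: bilinear_form_def bilinear_map_def Vector_Spaces.linear_iff)
  then show ?thesis
    by (auto simp: tensor_map_def tensor_def fun_eq_iff)
qed

lemma tensor_map_sum: "tensor_map s f g (\<Sum>i\<in>I. t i) = (\<Sum>i\<in>I. tensor_map s f g (t i))"
  by (auto simp: tensor_map_def fun_eq_iff sum_fun_apply)

lemma twist_tensor: "twist (x \<otimes>\<^bsub>s\<^esub> y) = y \<otimes>\<^bsub>s\<^esub> x"
  by (auto simp: twist_def tensor_def fun_eq_iff bilinear_form_def bilinear_map_def)

lemma twist_sum: "twist (\<Sum>i\<in>I. (t i :: ('a, 'k::field) tensor2)) = (\<Sum>i\<in>I. twist (t i))"
  by (auto simp: twist_def fun_eq_iff sum_fun_apply)

lemma twist_id_triple_tensor: "twist_id (triple_tensor s x y z) = triple_tensor s y x z"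
proof -
  have "trilinear_form s (\<lambda>x y z. w y x z) = trilinear_form s w" for w
    unfolding trilinear_form_def trilinear_map_def by blast
  then show ?thesis
    by (auto simp: twist_id_def triple_tensor_def fun_eq_iff)
qed

lemma comult_id_tensor:
  assumes "Vector_Spaces.linear s tensor_scale \<Delta>" and "\<Delta> x = (\<Sum>i<n. a i \<otimes>\<^bsub>s\<^esub> b i)"
    and "range \<Delta> \<subseteq> tensor_square s"
  shows "comult_id s \<Delta> (x \<otimes>\<^bsub>s\<^esub> y) = (\<Sum>i<n. triple_tensor s (a i) (b i) y)"
proof
  fix w
  show "comult_id s \<Delta> (x \<otimes>\<^bsub>s\<^esub> y) w = (\<Sum>i<n. triple_tensor s (a i) (b i) y) w"
  proof (cases "trilinear_form s w")
    case w: True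
    have bil: "bilinear_form s (\<lambda>u v. w u v y)" for y
      using w by (auto simp: trilinear_form_def trilinear_map_def bilinear_form_def bilinear_map_def)
    have lin: "Vector_Spaces.linear s (*) (\<lambda>y. \<Delta> x (\<lambda>u v. w u v y))" for x
    proof -
      obtain n a b where "\<Delta> x = (\<Sum>i<(n::nat). a i \<otimes>\<^bsub>s\<^esub> b i)"
        using assms(3) by (force simp: tensor_square_def)
      then have "(\<lambda>y. \<Delta> x (\<lambda>u v. w u v y)) = (\<lambda>y. \<Sum>i<n. w (a i) (b i) y)"
        using bil by (auto simp: sum_fun_apply tensor_def)
      then show ?thesis
        using w by (auto simp: trilinear_form_def trilinear_map_def Vector_Spaces.linear_iff
            sum.distrib sum_distrib_left)
    qed
    have "bilinear_form s (\<lambda>x y. \<Delta> x (\<lambda>u v. w u v y))"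
      using assms(1) lin vector_space_field
      by (auto simp: bilinear_form_def bilinear_map_def Vector_Spaces.linear_iff tensor_scale_def)
    then show ?thesis
      using w bil by (simp add: comult_id_def tensor_def assms(2) sum_fun_apply triple_tensor_def)
  qed (simp add: comult_id_def sum_fun_apply triple_tensor_def)
qed

lemma id_comult_tensor:
  assumes "Vector_Spaces.linear s tensor_scale \<Delta>" and "\<Delta> y = (\<Sum>i<n. a i \<otimes>\<^bsub>s\<^esub> b i)"
    and "range \<Delta> \<subseteq> tensor_square s"
  shows "id_comult s \<Delta> (x \<otimes>\<^bsub>s\<^esub> y) = (\<Sum>i<n. triple_tensor s x (a i) (b i))"
proof
  fix w
  show "id_comult s \<Delta> (x \<otimes>\<^bsub>s\<^esub> y) w = (\<Sum>i<n. triple_tensor s x (a i) (b i)) w"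
  proof (cases "trilinear_form s w")
    case w: True
    have bil: "bilinear_form s (w x)" for x
      using w by (auto simp: trilinear_form_def trilinear_map_def bilinear_form_def bilinear_map_def)
    have lin: "Vector_Spaces.linear s (*) (\<lambda>x. \<Delta> y (w x))" for y
    proof -
      obtain n a b where "\<Delta> y = (\<Sum>i<(n::nat). a i \<otimes>\<^bsub>s\<^esub> b i)"
        using assms(3) by (force simp: tensor_square_def)
      then have "(\<lambda>x. \<Delta> y (w x)) = (\<lambda>x. \<Sum>i<n. w x (a i) (b i))"
        using bil by (auto simp: sum_fun_apply tensor_def)
      then show ?thesis
        using w by (auto simp: trilinear_form_def trilinear_map_def Vector_Spaces.linear_iff
            sum.distrib sum_distrib_left)
    qed
    have "bilinear_form s (\<lambda>x y. \<Delta> y (w x))"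
      using assms(1) lin vector_space_field
      by (auto simp: bilinear_form_def bilinear_map_def Vector_Spaces.linear_iff tensor_scale_def)
    then show ?thesis
      using w bil by (simp add: id_comult_def tensor_def assms(2) sum_fun_apply triple_tensor_def)
  qed (simp add: id_comult_def sum_fun_apply triple_tensor_def)
qed


section \<open>Averaging pre-Lie algebras, coalgebras and bialgebras\<close>

definition lmult :: "('a \<Rightarrow> 'a \<Rightarrow> 'a) \<Rightarrow> 'a \<Rightarrow> 'a \<Rightarrow> 'a" where
  "lmult circ x y = circ x y"

definition rmult :: "('a \<Rightarrow> 'a \<Rightarrow> 'a) \<Rightarrow> 'a \<Rightarrow> 'a \<Rightarrow> 'a" where
  "rmult circ x y = circ y x"

locale pre_lie_algebra = vector_space scale
  for scale :: "'k::field \<Rightarrow> 'a::ab_group_add \<Rightarrow> 'a" +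
  fixes circ :: "'a \<Rightarrow> 'a \<Rightarrow> 'a" (infixl "\<odot>" 75)
  assumes bilinear_circ: "bilinear_map scale scale scale (\<odot>)"
    and pre_lie: "(x \<odot> y) \<odot> z - x \<odot> (y \<odot> z) = (y \<odot> x) \<odot> z - y \<odot> (x \<odot> z)"

locale averaging_pre_lie_algebra = pre_lie_algebra scale circ
  for scale :: "'k::field \<Rightarrow> 'a::ab_group_add \<Rightarrow> 'a"
    and circ :: "'a \<Rightarrow> 'a \<Rightarrow> 'a" (infixl "\<odot>" 75) +
  fixes P :: "'a \<Rightarrow> 'a"
  assumes linear_P: "Vector_Spaces.linear scale scale P"
    and averaging_left: "P x \<odot> P y = P (P x \<odot> y)"
    and averaging_right: "P x \<odot> P y = P (x \<odot> P y)"

locale admissible_averaging_pre_lie_algebra = averaging_pre_lie_algebra scale circ P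
  for scale :: "'k::field \<Rightarrow> 'a::ab_group_add \<Rightarrow> 'a"
    and circ :: "'a \<Rightarrow> 'a \<Rightarrow> 'a" (infixl "\<odot>" 75)
    and P :: "'a \<Rightarrow> 'a" +
  fixes S :: "'a \<Rightarrow> 'a"
  assumes linear_S: "Vector_Spaces.linear scale scale S"
    and admissible_PS: "P x \<odot> S y = S (P x \<odot> y)" "P x \<odot> S y = S (x \<odot> S y)"
    and admissible_SP: "S x \<odot> P y = S (x \<odot> P y)" "S x \<odot> P y = S (S x \<odot> y)"

locale pre_lie_coalgebra = vector_space scale
  for scale :: "'k::field \<Rightarrow> 'a::ab_group_add \<Rightarrow> 'a" +
  fixes \<Delta> :: "'a \<Rightarrow> ('a, 'k) tensor2"
  assumes comult_tensor_square: "\<Delta> x \<in> tensor_square scale"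
    and linear_comult: "Vector_Spaces.linear scale tensor_scale \<Delta>"
    and pre_lie_comult:
      "comult_id scale \<Delta> (\<Delta> x) - id_comult scale \<Delta> (\<Delta> x)
       = twist_id (comult_id scale \<Delta> (\<Delta> x) - id_comult scale \<Delta> (\<Delta> x))"

locale averaging_pre_lie_coalgebra = pre_lie_coalgebra scale \<Delta>
  for scale :: "'k::field \<Rightarrow> 'a::ab_group_add \<Rightarrow> 'a"
    and \<Delta> :: "'a \<Rightarrow> ('a, 'k) tensor2" +
  fixes S :: "'a \<Rightarrow> 'a"
  assumes linear_S: "Vector_Spaces.linear scale scale S"
    and averaging_comult_left: "tensor_map scale S S (\<Delta> x) = tensor_map scale S id (\<Delta> (S x))"
    and averaging_comult_right: "tensor_map scale S S (\<Delta> x) = tensor_map scale id S (\<Delta> (S x))"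

locale pre_lie_bialgebra = pre_lie_algebra scale circ + pre_lie_coalgebra scale \<Delta>
  for scale :: "'k::field \<Rightarrow> 'a::ab_group_add \<Rightarrow> 'a"
    and circ :: "'a \<Rightarrow> 'a \<Rightarrow> 'a" (infixl "\<odot>" 75)
    and \<Delta> :: "'a \<Rightarrow> ('a, 'k) tensor2" +
  assumes comult_commutator:
      "\<Delta> (x \<odot> y - y \<odot> x) =
         (tensor_map scale (lmult circ x) id
           + tensor_map scale id (lmult circ x - rmult circ x)) (\<Delta> y)
       - (tensor_map scale (lmult circ y) id
           + tensor_map scale id (lmult circ y - rmult circ y)) (\<Delta> x)"
    and comult_circ:
      "(id - twist) (\<Delta> (x \<odot> y)) =
         (id - twist) (tensor_map scale id (rmult circ y) (\<Delta> x)
           + (tensor_map scale (lmult circ x) id + tensor_map scale id (lmult circ x)) (\<Delta> y))"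

locale averaging_pre_lie_bialgebra =
    admissible_averaging_pre_lie_algebra scale circ P S
  + averaging_pre_lie_coalgebra scale \<Delta> S
  + pre_lie_bialgebra scale circ \<Delta>
  for scale :: "'k::field \<Rightarrow> 'a::ab_group_add \<Rightarrow> 'a"
    and circ :: "'a \<Rightarrow> 'a \<Rightarrow> 'a" (infixl "\<odot>" 75)
    and \<Delta> :: "'a \<Rightarrow> ('a, 'k) tensor2"
    and P :: "'a \<Rightarrow> 'a"
    and S :: "'a \<Rightarrow> 'a" +
  assumes comult_PS:
      "tensor_map scale P S (\<Delta> x) = tensor_map scale id S (\<Delta> (P x))"
      "tensor_map scale P S (\<Delta> x) = tensor_map scale P id (\<Delta> (P x))"
    and comult_SP:
      "tensor_map scale S P (\<Delta> x) = tensor_map scale S id (\<Delta> (P x))"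
      "tensor_map scale S P (\<Delta> x) = tensor_map scale id P (\<Delta> (P x))"

text \<open>
  In the next definition both sides of the quadratic equation are independent of the chosen
  decomposition \<open>r = \<Sum> a i \<otimes> b i\<close> (by two applications of \<open>tensor_lift\<close>), so it does
  not matter that some decomposition is asked for rather than all.
\<close>
definition admissible_cybe_solution ::
    "('k::field \<Rightarrow> 'a::ab_group_add \<Rightarrow> 'a) \<Rightarrow> ('a \<Rightarrow> 'a \<Rightarrow> 'a) \<Rightarrow> ('a \<Rightarrow> 'a) \<Rightarrow> ('a \<Rightarrow> 'a)
      \<Rightarrow> ('a, 'k) tensor2 \<Rightarrow> bool" where
  "admissible_cybe_solution s circ P S r \<longleftrightarrow>
     (\<exists>(n::nat) a b.
        r = (\<Sum>i<n. a i \<otimes>\<^bsub>s\<^esub> b i) \<and>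
        (\<Sum>i<n. \<Sum>j<n. triple_tensor s (a i) (circ (b i) (a j)) (b j)
                     + triple_tensor s (a i) (a j) (circ (b i) (b j)))
        = (\<Sum>i<n. \<Sum>j<n. triple_tensor s (circ (a i) (a j)) (b i) (b j)
                     + triple_tensor s (a i) (a j) (circ (b j) (b i)))) \<and>
     (tensor_map s S id - tensor_map s id P) r = 0 \<and>
     (tensor_map s P id - tensor_map s id S) r = 0"

definition symmetric_tensor :: "('a, 'k) tensor2 \<Rightarrow> bool" where
  "symmetric_tensor r \<longleftrightarrow> twist r = r"

definition coboundary ::
    "('k::field \<Rightarrow> 'a::ab_group_add \<Rightarrow> 'a) \<Rightarrow> ('a \<Rightarrow> 'a \<Rightarrow> 'a) \<Rightarrow> ('a, 'k) tensor2
      \<Rightarrow> 'a \<Rightarrow> ('a, 'k) tensor2" where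
  "coboundary s circ r x =
     (tensor_map s (lmult circ x) id + tensor_map s id (lmult circ x - rmult circ x)) r"

end

theory Submission
  imports Defs
begin

text \<open>
  Each identity that is linear in \<open>r\<close> is an identity between operators \<open>f \<otimes> g\<close> applied to \<open>r\<close>: the
  cocycle condition says that \<open>L \<otimes> id + id \<otimes> (L - R)\<close> is a representation of the commutator Lie
  algebra, in the other bialgebra condition symmetry of \<open>r\<close> removes all but the terms with \<open>R\<close>, and
  for the averaging conditions one moves \<open>P\<close> and \<open>S\<close> from one leg of \<open>r\<close> to the other until
  admissibility applies. Only the pre-Lie coalgebra identity is quadratic in \<open>r\<close>: its defect at \<open>x\<close> is,
  up to sign, the action of \<open>x\<close> on the Yang-Baxter expression of \<open>r\<close>.
\<close>

section \<open>Maps on the tensor square\<close>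

lemma bilinear_form_flip: "bilinear_form s (\<lambda>x y. w y x) \<longleftrightarrow> bilinear_form s w"
  unfolding bilinear_form_def bilinear_map_def by blast

lemma bilinear_form_compose:
  assumes "bilinear_form s w" "Vector_Spaces.linear s s f" "Vector_Spaces.linear s s g"
  shows "bilinear_form s (\<lambda>x y. w (f x) (g y))"
  using assms by (auto simp: bilinear_form_def bilinear_map_def Vector_Spaces.linear_iff)

lemma sum_tensor_apply:
  "bilinear_form s w \<Longrightarrow> (\<Sum>i\<in>I. a i \<otimes>\<^bsub>s\<^esub> b i) w = (\<Sum>i\<in>I. w (a i) (b i))"
  by (simp add: sum_fun_apply tensor_def)

lemma sum_tensor_square: "(\<Sum>i<(n::nat). a i \<otimes>\<^bsub>s\<^esub> b i) \<in> tensor_square s"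
  unfolding tensor_square_def by (intro CollectI exI[of _ n] exI[of _ a] exI[of _ b]) simp

lemma tensor_square_add:
  assumes "t \<in> tensor_square s" "u \<in> tensor_square s"
  shows "t + u \<in> tensor_square s"
proof -
  obtain n a b m c d
    where t: "t = (\<Sum>i<(n::nat). a i \<otimes>\<^bsub>s\<^esub> b i)" and u: "u = (\<Sum>i<(m::nat). c i \<otimes>\<^bsub>s\<^esub> d i)"
    using assms by (auto simp: tensor_square_def)
  have *: "(\<Sum>i<n + m. f i) = (\<Sum>i<n. f i) + (\<Sum>i<m. f (n + i))" for f :: "nat \<Rightarrow> ('a, 'b) tensor2"
    by (induction m) (auto simp: add.assoc)
  have "t + u = (\<Sum>i<n + m. (if i < n then a i else c (i - n)) \<otimes>\<^bsub>s\<^esub> (if i < n then b i else d (i - n)))"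
    unfolding * t u by simp
  then show ?thesis
    by (simp only: sum_tensor_square)
qed

lemma tensor_map_tensor_square:
  assumes "t \<in> tensor_square s" "Vector_Spaces.linear s s f" "Vector_Spaces.linear s s g"
  shows "tensor_map s f g t \<in> tensor_square s"
proof -
  obtain n a b where "t = (\<Sum>i<(n::nat). a i \<otimes>\<^bsub>s\<^esub> b i)"
    using assms(1) by (auto simp: tensor_square_def)
  then have "tensor_map s f g t = (\<Sum>i<n. f (a i) \<otimes>\<^bsub>s\<^esub> g (b i))"
    by (simp add: tensor_map_sum tensor_map_tensor assms)
  then show ?thesis
    by (simp only: sum_tensor_square)
qed

lemma tensor_map_add: "tensor_map s f g (t + u) = tensor_map s f g t + tensor_map s f g u"
  by (auto simp: tensor_map_def fun_eq_iff)

lemma tensor_map_compose: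
  assumes "Vector_Spaces.linear s s f" "Vector_Spaces.linear s s g"
  shows "tensor_map s f g (tensor_map s f' g' t) = tensor_map s (f \<circ> f') (g \<circ> g') t"
  using bilinear_form_compose[OF _ assms] by (auto simp: tensor_map_def fun_eq_iff)

lemma twist_tensor_map: "twist (tensor_map s f g t) = tensor_map s g f (twist t)"
proof
  show "twist (tensor_map s f g t) w = tensor_map s g f (twist t) w" for w
    using bilinear_form_flip[of s w] by (simp add: twist_def tensor_map_def)
qed

lemma twist_add: "twist (t + u) = twist t + twist u"
  by (auto simp: twist_def fun_eq_iff)

lemma twist_diff: "twist (t - u) = twist t - twist (u :: ('a, 'k::field) tensor2)"
  by (auto simp: twist_def fun_eq_iff)

lemma tensor_map_sum_tensor_apply:
  assumes "bilinear_form s w" "Vector_Spaces.linear s s f" "Vector_Spaces.linear s s g"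
  shows "tensor_map s f g (\<Sum>i\<in>I. a i \<otimes>\<^bsub>s\<^esub> b i) w = (\<Sum>i\<in>I. w (f (a i)) (g (b i)))"
  using assms by (simp add: tensor_map_sum tensor_map_tensor sum_tensor_apply)

lemma tensor_map_diff: "tensor_map s f g (t - u) = tensor_map s f g t - tensor_map s f g u"
  by (auto simp: tensor_map_def fun_eq_iff)

lemma linear_add_map:
  assumes "Vector_Spaces.linear s s f" "Vector_Spaces.linear s s f'"
  shows "Vector_Spaces.linear s s (f + f')"
proof -
  interpret vector_space s
    using assms by (simp add: Vector_Spaces.linear_iff)
  show ?thesis
    using assms by (auto simp: Vector_Spaces.linear_iff scale_right_distrib)
qed

lemma linear_diff_map:
  assumes "Vector_Spaces.linear s s f" "Vector_Spaces.linear s s f'"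
  shows "Vector_Spaces.linear s s (f - f')"
proof -
  interpret vector_space s
    using assms by (simp add: Vector_Spaces.linear_iff)
  show ?thesis
    using assms by (auto simp: Vector_Spaces.linear_iff scale_right_diff_distrib)
qed

lemma comp_diff_linear:
  assumes "Vector_Spaces.linear s s f"
  shows "f \<circ> (g - h) = (f \<circ> g) - (f \<circ> h)"
proof -
  interpret Vector_Spaces.linear s s f
    by (rule assms)
  show ?thesis
    by (simp add: fun_eq_iff diff)
qed

lemma diff_comp_map: "(g - h) \<circ> (f :: 'a \<Rightarrow> 'b) = (g \<circ> f) - (h \<circ> f)"
  by (simp add: fun_eq_iff)

lemma tensor_map_add_left:
  assumes t: "t \<in> tensor_square s"
    and lin: "Vector_Spaces.linear s s f" "Vector_Spaces.linear s s f'" "Vector_Spaces.linear s s g"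
  shows "tensor_map s (f + f') g t = tensor_map s f g t + tensor_map s f' g t"
proof
  fix w
  obtain n a b where t: "t = (\<Sum>i<(n::nat). a i \<otimes>\<^bsub>s\<^esub> b i)"
    using t by (auto simp: tensor_square_def)
  show "tensor_map s (f + f') g t w = (tensor_map s f g t + tensor_map s f' g t) w"
  proof (cases "bilinear_form s w")
    case True
    then have "w (x + y) z = w x z + w y z" for x y z
      by (auto simp: bilinear_form_def bilinear_map_def Vector_Spaces.linear_iff)
    with True show ?thesis
      by (simp add: t tensor_map_sum_tensor_apply lin linear_add_map sum.distrib)
  qed (simp add: tensor_map_def)
qed

lemma tensor_map_diff_left:
  assumes "t \<in> tensor_square s"
    and "Vector_Spaces.linear s s f" "Vector_Spaces.linear s s f'" "Vector_Spaces.linear s s g"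
  shows "tensor_map s (f - f') g t = tensor_map s f g t - tensor_map s f' g t"
  using tensor_map_add_left[OF assms(1) linear_diff_map[OF assms(2,3)] assms(3,4)]
  by (simp add: algebra_simps)

lemma twist_twist: "twist (twist t) = t"
  by (simp add: twist_def)

lemma tensor_map_flip: "tensor_map s f g t = twist (tensor_map s g f (twist t))"
  by (simp add: twist_tensor_map twist_twist)

lemma twist_tensor_square:
  assumes "t \<in> tensor_square s"
  shows "twist t \<in> tensor_square s"
proof -
  obtain n a b where "t = (\<Sum>i<(n::nat). a i \<otimes>\<^bsub>s\<^esub> b i)"
    using assms by (auto simp: tensor_square_def)
  then show ?thesis
    by (simp only: twist_sum twist_tensor sum_tensor_square)
qed

lemma tensor_map_add_right:
  assumes "t \<in> tensor_square s"
    and "Vector_Spaces.linear s s f" "Vector_Spaces.linear s s g" "Vector_Spaces.linear s s g'"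
  shows "tensor_map s f (g + g') t = tensor_map s f g t + tensor_map s f g' t"
  unfolding tensor_map_flip[of s f]
  by (simp add: tensor_map_add_left twist_tensor_square assms twist_add)

lemma tensor_map_diff_right:
  assumes "t \<in> tensor_square s"
    and "Vector_Spaces.linear s s f" "Vector_Spaces.linear s s g" "Vector_Spaces.linear s s g'"
  shows "tensor_map s f (g - g') t = tensor_map s f g t - tensor_map s f g' t"
  using tensor_map_add_right[OF assms(1,2) linear_diff_map[OF assms(3,4)] assms(4)]
  by (simp add: algebra_simps)

text \<open>With \<open>r = \<Sum> a i \<otimes> b i\<close>, the arguments \<open>p p'\<close> and \<open>q q'\<close> of the summand below are the two legs
  of two independent copies of \<open>r\<close>.\<close>

definition pair_sum ::
    "nat \<Rightarrow> (nat \<Rightarrow> 'a) \<Rightarrow> (nat \<Rightarrow> 'a) \<Rightarrow> ('a \<Rightarrow> 'a \<Rightarrow> 'a \<Rightarrow> 'a \<Rightarrow> 'k::ab_group_add) \<Rightarrow> 'k" where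
  "pair_sum n a b h = (\<Sum>i<n. \<Sum>j<n. h (a i) (b i) (a j) (b j))"

lemma pair_sum_add:
  "pair_sum n a b (\<lambda>p p' q q'. h p p' q q' + h' p p' q q') = pair_sum n a b h + pair_sum n a b h'"
  by (simp add: pair_sum_def sum.distrib)

lemma pair_sum_diff:
  "pair_sum n a b (\<lambda>p p' q q'. h p p' q q' - h' p p' q q') = pair_sum n a b h - pair_sum n a b h'"
  by (simp add: pair_sum_def sum_subtractf)

lemma pair_sum_exchange:
  "pair_sum n a b h = pair_sum n a b (\<lambda>p p' q q'. h q q' p p')"
  unfolding pair_sum_def by (rule sum.swap)

section \<open>Coboundaries on a pre-Lie algebra\<close>

context pre_lie_algebra
begin

abbreviation "L \<equiv> lmult (\<odot>)"
abbreviation "R \<equiv> rmult (\<odot>)"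
abbreviation "ad x \<equiv> L x - R x"

lemma circ_simps [simp]:
  "(x + y) \<odot> z = x \<odot> z + y \<odot> z" "x \<odot> (y + z) = x \<odot> y + x \<odot> z"
  "scale c x \<odot> z = scale c (x \<odot> z)" "x \<odot> scale c z = scale c (x \<odot> z)"
  using bilinear_circ by (auto simp: bilinear_map_def Vector_Spaces.linear_iff)

lemma circ_zero [simp]: "0 \<odot> x = 0" "x \<odot> 0 = 0"
  using circ_simps(1)[of 0 0 x] circ_simps(2)[of x 0 0] by simp_all

lemma circ_diff [simp]: "(x - y) \<odot> z = x \<odot> z - y \<odot> z" "z \<odot> (x - y) = z \<odot> x - z \<odot> y"
  by (metis add_diff_cancel diff_add_cancel circ_simps(1))
     (metis add_diff_cancel diff_add_cancel circ_simps(2))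

lemma linear_endomorphisms [simp]:
  "Vector_Spaces.linear scale scale (L x)" "Vector_Spaces.linear scale scale (R x)"
  "Vector_Spaces.linear scale scale (ad x)" "Vector_Spaces.linear scale scale id"
  using vector_space_axioms
  by (auto simp: lmult_def rmult_def Vector_Spaces.linear_iff scale_right_diff_distrib)

lemma linear_comp [simp]:
  "Vector_Spaces.linear scale scale f \<Longrightarrow> Vector_Spaces.linear scale scale g \<Longrightarrow>
    Vector_Spaces.linear scale scale (f \<circ> g)"
  by (auto simp: Vector_Spaces.linear_iff)

lemma coboundary_eq:
  "coboundary scale (\<odot>) r x = tensor_map scale (L x) id r + tensor_map scale id (ad x) r"
  by (simp add: coboundary_def)

lemma L_commutator: "L (x \<odot> y - y \<odot> x) = (L x \<circ> L y) - (L y \<circ> L x)"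
proof
  show "L (x \<odot> y - y \<odot> x) z = ((L x \<circ> L y) - (L y \<circ> L x)) z" for z
    using pre_lie[of x y z] by (simp add: lmult_def) (simp add: algebra_simps)
qed

lemma ad_commutator: "ad (x \<odot> y - y \<odot> x) = (ad x \<circ> ad y) - (ad y \<circ> ad x)"
proof
  fix z
  have *: "x \<odot> (y \<odot> z) = (x \<odot> y) \<odot> z - (y \<odot> x) \<odot> z + y \<odot> (x \<odot> z)"
    "x \<odot> (z \<odot> y) = (x \<odot> z) \<odot> y - (z \<odot> x) \<odot> y + z \<odot> (x \<odot> y)"
    "y \<odot> (z \<odot> x) = (y \<odot> z) \<odot> x - (z \<odot> y) \<odot> x + z \<odot> (y \<odot> x)"
    using pre_lie[of x y z] pre_lie[of x z y] pre_lie[of y z x] by (simp_all add: algebra_simps)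
  show "ad (x \<odot> y - y \<odot> x) z = ((ad x \<circ> ad y) - (ad y \<circ> ad x)) z"
    by (simp add: lmult_def rmult_def *)
qed

lemma R_circ: "R (x \<odot> y) = (L x \<circ> R y) - (R y \<circ> ad x)"
proof
  fix z
  show "R (x \<odot> y) z = ((L x \<circ> R y) - (R y \<circ> ad x)) z"
    using pre_lie[of x z y] by (simp add: lmult_def rmult_def) (simp add: algebra_simps)
qed

context
  fixes r
  assumes r: "r \<in> tensor_square scale"
begin

lemma coboundary_tensor_square: "coboundary scale (\<odot>) r x \<in> tensor_square scale"
  unfolding coboundary_eq by (intro tensor_square_add tensor_map_tensor_square r) simp_all

lemma linear_coboundary: "Vector_Spaces.linear scale tensor_scale (coboundary scale (\<odot>) r)"
proof -
  obtain n a b where eq: "r = (\<Sum>i<(n::nat). a i \<otimes>\<^bsub>scale\<^esub> b i)"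
    using r by (auto simp: tensor_square_def)
  have "L (x + y) = L x + L y" "ad (x + y) = ad x + ad y" for x y
    by (auto simp: lmult_def rmult_def fun_eq_iff)
  then have "coboundary scale (\<odot>) r (x + y) = coboundary scale (\<odot>) r x + coboundary scale (\<odot>) r y"
    for x y
    by (simp only: coboundary_eq tensor_map_add_left tensor_map_add_right r linear_endomorphisms)
      (simp add: algebra_simps)
  moreover have "coboundary scale (\<odot>) r (scale c x) = tensor_scale c (coboundary scale (\<odot>) r x)"
    for c x
  proof
    fix w
    show "coboundary scale (\<odot>) r (scale c x) w = tensor_scale c (coboundary scale (\<odot>) r x) w"
    proof (cases "bilinear_form scale w")
      case True
      then have w: "w (scale c u) v = c * w u v" "w u (scale c v) = c * w u v" for u v
        by (auto simp: bilinear_form_def bilinear_map_def Vector_Spaces.linear_iff)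
      have "L (scale c x) u = scale c (L x u)" "ad (scale c x) u = scale c (ad x u)" for u
        by (auto simp: lmult_def rmult_def scale_right_diff_distrib)
      then show ?thesis
        by (simp only: coboundary_eq tensor_scale_def plus_fun_apply eq True linear_endomorphisms
            tensor_map_sum_tensor_apply w sum_distrib_left distrib_left id_apply)
    qed (simp add: coboundary_eq tensor_map_def tensor_scale_def)
  qed
  ultimately show ?thesis
    using vector_space_axioms vector_space_tensor_scale by (auto simp: Vector_Spaces.linear_iff)
qed

lemmas tensor_map_rules =
  tensor_map_add tensor_map_compose tensor_map_add_left tensor_map_add_right
  tensor_map_diff_left tensor_map_diff_right tensor_map_diff
  comp_diff_linear[OF linear_endomorphisms(1)] comp_diff_linear[OF linear_endomorphisms(2)]
  diff_comp_map linear_add_map linear_diff_map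

lemma coboundary_commutator:
  "coboundary scale (\<odot>) r (x \<odot> y - y \<odot> x) =
     (tensor_map scale (L x) id + tensor_map scale id (ad x)) (coboundary scale (\<odot>) r y)
   - (tensor_map scale (L y) id + tensor_map scale id (ad y)) (coboundary scale (\<odot>) r x)"
  unfolding coboundary_eq ad_commutator
  by (simp only: L_commutator tensor_map_rules r linear_endomorphisms linear_comp id_comp comp_id
      plus_fun_apply)
     (simp add: algebra_simps)

lemma coboundary_circ:
  assumes "symmetric_tensor r"
  shows "(id - twist) (coboundary scale (\<odot>) r (x \<odot> y)) =
     (id - twist) (tensor_map scale id (R y) (coboundary scale (\<odot>) r x)
       + (tensor_map scale (L x) id + tensor_map scale id (L x)) (coboundary scale (\<odot>) r y))"
  using assms unfolding coboundary_eq R_circ symmetric_tensor_def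
  by (simp only: plus_fun_apply tensor_map_rules r linear_endomorphisms linear_comp id_comp comp_id
      twist_tensor_map twist_add twist_diff minus_apply id_apply)
     (simp add: algebra_simps)

end

section \<open>The co-pre-Lie identity\<close>

lemma trilinear_simps:
  assumes "trilinear_form scale w"
  shows "w (x + x') y z = w x y z + w x' y z" "w x (y + y') z = w x y z + w x y' z"
    "w x y (z + z') = w x y z + w x y z'"
    "w (scale c x) y z = c * w x y z" "w x (scale c y) z = c * w x y z"
    "w x y (scale c z) = c * w x y z"
    "w (x - x') y z = w x y z - w x' y z" "w x (y - y') z = w x y z - w x y' z"
    "w x y (z - z') = w x y z - w x y z'"
proof -
  show add: "w (x + x') y z = w x y z + w x' y z" "w x (y + y') z = w x y z + w x y' z"
    "w x y (z + z') = w x y z + w x y z'"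
    "w (scale c x) y z = c * w x y z" "w x (scale c y) z = c * w x y z"
    "w x y (scale c z) = c * w x y z" for x x' y y' z z'
    using assms by (auto simp: trilinear_form_def trilinear_map_def Vector_Spaces.linear_iff)
  show "w (x - x') y z = w x y z - w x' y z" "w x (y - y') z = w x y z - w x y' z"
    "w x y (z - z') = w x y z - w x y z'"
    by (simp_all only: eq_diff_eq add(1-3)[symmetric] diff_add_cancel)
qed

lemma bilinear_formI:
  assumes "\<And>x x' y. w (x + x') y = w x y + w x' y" "\<And>x y y'. w x (y + y') = w x y + w x y'"
    "\<And>c x y. w (scale c x) y = c * w x y" "\<And>c x y. w x (scale c y) = c * w x y"
  shows "bilinear_form scale w"
  using assms vector_space_axioms vector_space_field
  by (auto simp: bilinear_form_def bilinear_map_def Vector_Spaces.linear_iff)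

lemma trilinear_formI:
  assumes "\<And>x x' y z. w (x + x') y z = w x y z + w x' y z"
    "\<And>x y y' z. w x (y + y') z = w x y z + w x y' z"
    "\<And>x y z z'. w x y (z + z') = w x y z + w x y z'"
    "\<And>c x y z. w (scale c x) y z = c * w x y z" "\<And>c x y z. w x (scale c y) z = c * w x y z"
    "\<And>c x y z. w x y (scale c z) = c * w x y z"
  shows "trilinear_form scale w"
  using assms vector_space_axioms vector_space_field
  by (auto simp: trilinear_form_def trilinear_map_def Vector_Spaces.linear_iff)

lemma coboundary_sum_apply:
  assumes "bilinear_form scale w"
  shows "coboundary scale (\<odot>) (\<Sum>i<(n::nat). a i \<otimes>\<^bsub>scale\<^esub> b i) x w
    = (\<Sum>i<n. w (x \<odot> a i) (b i) + w (a i) (x \<odot> b i - b i \<odot> x))"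
  unfolding coboundary_eq plus_fun_apply tensor_map_sum_tensor_apply[OF assms linear_endomorphisms(1,4)]
    tensor_map_sum_tensor_apply[OF assms linear_endomorphisms(4,3)]
  by (simp add: sum.distrib lmult_def rmult_def)

context
  fixes r :: "('a, 'k) tensor2" and n :: nat and a b :: "nat \<Rightarrow> 'a"
  assumes r_eq: "r = (\<Sum>i<n. a i \<otimes>\<^bsub>scale\<^esub> b i)"
    and sym: "symmetric_tensor r"
begin

lemma sum_flip:
  assumes "bilinear_form scale w"
  shows "(\<Sum>i<n. w (a i) (b i)) = (\<Sum>i<n. w (b i) (a i))"
proof -
  have "r w = twist r w"
    using sym by (simp add: symmetric_tensor_def)
  then show ?thesis
    using assms by (simp add: r_eq twist_sum twist_tensor sum_tensor_apply)
qed

lemma pair_sum_flip_right: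
  assumes "\<And>p p'. bilinear_form scale (h p p')"
  shows "pair_sum n a b h = pair_sum n a b (\<lambda>p p' q q'. h p p' q' q)"
  unfolding pair_sum_def by (intro sum.cong refl sum_flip assms)

lemma pair_sum_flip_left:
  assumes "\<And>q q'. bilinear_form scale (\<lambda>p p'. h p p' q q')"
  shows "pair_sum n a b h = pair_sum n a b (\<lambda>p p' q q'. h p' p q q')"
  by (subst (1 2) pair_sum_exchange) (rule pair_sum_flip_right[OF assms])

lemma comult_id_coboundary:
  fixes x
  assumes w: "trilinear_form scale w"
  defines "\<Delta> \<equiv> coboundary scale (\<odot>) r"
  shows "comult_id scale \<Delta> (\<Delta> x) w = pair_sum n a b (\<lambda>p p' q q'.
      w ((x \<odot> q) \<odot> p) p' q' + w (q \<odot> p) p' (x \<odot> q' - q' \<odot> x)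
    + (w p' ((x \<odot> q) \<odot> p - p \<odot> (x \<odot> q)) q' + w p' (q \<odot> p - p \<odot> q) (x \<odot> q' - q' \<odot> x)))"
proof -
  note ws = trilinear_simps[OF w]
  have bil: "bilinear_form scale (\<lambda>u v. w u v z)" for z
    by (rule bilinear_formI) (simp_all add: ws)
  have "comult_id scale \<Delta> (\<Delta> x) w = \<Delta> x (\<lambda>y z. \<Sum>j<n. w (y \<odot> a j) (b j) z + w (a j) (y \<odot> b j - b j \<odot> y) z)"
    using w by (simp add: comult_id_def \<Delta>_def r_eq coboundary_sum_apply[OF bil])
  also have "\<dots> = (\<Sum>i<n. (\<Sum>j<n. w (x \<odot> a i \<odot> a j) (b j) (b i) + w (a j) (x \<odot> a i \<odot> b j - b j \<odot> (x \<odot> a i)) (b i))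
     + (\<Sum>j<n. w (a i \<odot> a j) (b j) (x \<odot> b i - b i \<odot> x) + w (a j) (a i \<odot> b j - b j \<odot> a i) (x \<odot> b i - b i \<odot> x)))"
    unfolding \<Delta>_def r_eq
    by (rule coboundary_sum_apply, rule bilinear_formI)
      (simp_all add: ws sum.distrib sum_subtractf sum_distrib_left algebra_simps)
  also have "\<dots> = pair_sum n a b (\<lambda>q q' p p'. w ((x \<odot> q) \<odot> p) p' q' + w (q \<odot> p) p' (x \<odot> q' - q' \<odot> x))
     + pair_sum n a b (\<lambda>q q' p p'. w p ((x \<odot> q) \<odot> p' - p' \<odot> (x \<odot> q)) q' + w p (q \<odot> p' - p' \<odot> q) (x \<odot> q' - q' \<odot> x))"
    by (simp add: pair_sum_def sum.distrib)
  also have "pair_sum n a b (\<lambda>q q' p p'. w p ((x \<odot> q) \<odot> p' - p' \<odot> (x \<odot> q)) q' + w p (q \<odot> p' - p' \<odot> q) (x \<odot> q' - q' \<odot> x))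
     = pair_sum n a b (\<lambda>q q' p p'. w p' ((x \<odot> q) \<odot> p - p \<odot> (x \<odot> q)) q' + w p' (q \<odot> p - p \<odot> q) (x \<odot> q' - q' \<odot> x))"
    by (rule pair_sum_flip_right, rule bilinear_formI) (simp_all add: ws algebra_simps)
  finally show ?thesis
    unfolding pair_sum_add[symmetric] by (subst pair_sum_exchange)
qed

lemma id_comult_coboundary:
  fixes x
  assumes w: "trilinear_form scale w"
  defines "\<Delta> \<equiv> coboundary scale (\<odot>) r"
  shows "id_comult scale \<Delta> (\<Delta> x) w = pair_sum n a b (\<lambda>p p' q q'.
      w (x \<odot> p') (p \<odot> q) q' + w p' ((x \<odot> p - p \<odot> x) \<odot> q) q')
    + pair_sum n a b (\<lambda>p p' q q'. w (x \<odot> p') q' (p \<odot> q - q \<odot> p)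
      + w p' q' ((x \<odot> p - p \<odot> x) \<odot> q - q \<odot> (x \<odot> p - p \<odot> x)))"
proof -
  note ws = trilinear_simps[OF w]
  have bil: "bilinear_form scale (w y)" for y
    by (rule bilinear_formI) (simp_all add: ws)
  have "id_comult scale \<Delta> (\<Delta> x) w = \<Delta> x (\<lambda>y z. \<Sum>j<n. w y (z \<odot> a j) (b j) + w y (a j) (z \<odot> b j - b j \<odot> z))"
    using w by (simp add: id_comult_def \<Delta>_def r_eq coboundary_sum_apply[OF bil])
  also have "\<dots> = (\<Sum>i<n. (\<Sum>j<n. w (x \<odot> a i) (b i \<odot> a j) (b j) + w (x \<odot> a i) (a j) (b i \<odot> b j - b j \<odot> b i))
     + (\<Sum>j<n. w (a i) ((x \<odot> b i - b i \<odot> x) \<odot> a j) (b j)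
        + w (a i) (a j) ((x \<odot> b i - b i \<odot> x) \<odot> b j - b j \<odot> (x \<odot> b i - b i \<odot> x))))"
    unfolding \<Delta>_def r_eq
    by (rule coboundary_sum_apply, rule bilinear_formI)
      (simp_all add: ws sum.distrib sum_subtractf sum_distrib_left algebra_simps)
  also have "\<dots> = pair_sum n a b (\<lambda>p p' q q'. w (x \<odot> p) (p' \<odot> q) q' + w p ((x \<odot> p' - p' \<odot> x) \<odot> q) q')
     + pair_sum n a b (\<lambda>p p' q q'. w (x \<odot> p) q (p' \<odot> q' - q' \<odot> p')
      + w p q ((x \<odot> p' - p' \<odot> x) \<odot> q' - q' \<odot> (x \<odot> p' - p' \<odot> x)))"
    by (simp add: pair_sum_def sum.distrib)
  also have "pair_sum n a b (\<lambda>p p' q q'. w (x \<odot> p) (p' \<odot> q) q' + w p ((x \<odot> p' - p' \<odot> x) \<odot> q) q')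
     = pair_sum n a b (\<lambda>p p' q q'. w (x \<odot> p') (p \<odot> q) q' + w p' ((x \<odot> p - p \<odot> x) \<odot> q) q')"
    by (rule pair_sum_flip_left, rule bilinear_formI) (simp_all add: ws scale_right_diff_distrib algebra_simps)
  also have "pair_sum n a b (\<lambda>p p' q q'. w (x \<odot> p) q (p' \<odot> q' - q' \<odot> p')
      + w p q ((x \<odot> p' - p' \<odot> x) \<odot> q' - q' \<odot> (x \<odot> p' - p' \<odot> x)))
     = pair_sum n a b (\<lambda>p p' q q'. w (x \<odot> p') q (p \<odot> q' - q' \<odot> p)
      + w p' q ((x \<odot> p - p \<odot> x) \<odot> q' - q' \<odot> (x \<odot> p - p \<odot> x)))"
    by (rule pair_sum_flip_left, rule bilinear_formI) (simp_all add: ws algebra_simps)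
  also have "\<dots> = pair_sum n a b (\<lambda>p p' q q'. w (x \<odot> p') q' (p \<odot> q - q \<odot> p)
      + w p' q' ((x \<odot> p - p \<odot> x) \<odot> q - q \<odot> (x \<odot> p - p \<odot> x)))"
    by (rule pair_sum_flip_right, rule bilinear_formI) (simp_all add: ws algebra_simps)
  finally show ?thesis .
qed

context
  assumes cybe: "(\<Sum>i<n. \<Sum>j<n. triple_tensor scale (a i) (b i \<odot> a j) (b j)
                     + triple_tensor scale (a i) (a j) (b i \<odot> b j))
        = (\<Sum>i<n. \<Sum>j<n. triple_tensor scale (a i \<odot> a j) (b i) (b j)
                     + triple_tensor scale (a i) (a j) (b j \<odot> b i))"
begin

lemma cybe_pair_sum:
  assumes w: "trilinear_form scale w"
  shows "pair_sum n a b (\<lambda>p p' q q'. w p' (p \<odot> q) q' + w p' q' (p \<odot> q - q \<odot> p) - w (p \<odot> q) p' q') = 0"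
proof -
  note ws = trilinear_simps[OF w]
  have "pair_sum n a b (\<lambda>p p' q q'. w p (p' \<odot> q) q') + pair_sum n a b (\<lambda>p p' q q'. w p q (p' \<odot> q' - q' \<odot> p'))
     = pair_sum n a b (\<lambda>p p' q q'. w (p \<odot> q) p' q')"
    using fun_cong[OF cybe, of w] w
    by (simp add: pair_sum_def sum_fun_apply triple_tensor_def ws sum.distrib sum_subtractf)
      (simp add: algebra_simps)
  moreover have "pair_sum n a b (\<lambda>p p' q q'. w p (p' \<odot> q) q') = pair_sum n a b (\<lambda>p p' q q'. w p' (p \<odot> q) q')"
    by (rule pair_sum_flip_left, rule bilinear_formI) (simp_all add: ws)
  moreover have "pair_sum n a b (\<lambda>p p' q q'. w p q (p' \<odot> q' - q' \<odot> p'))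
     = pair_sum n a b (\<lambda>p p' q q'. w p' q (p \<odot> q' - q' \<odot> p))"
    by (rule pair_sum_flip_left, rule bilinear_formI) (simp_all add: ws algebra_simps)
  moreover have "\<dots> = pair_sum n a b (\<lambda>p p' q q'. w p' q' (p \<odot> q - q \<odot> p))"
    by (rule pair_sum_flip_right, rule bilinear_formI) (simp_all add: ws algebra_simps)
  ultimately show ?thesis
    by (simp add: pair_sum_add pair_sum_diff)
qed

lemma pre_lie_coboundary:
  fixes x
  defines "\<Delta> \<equiv> coboundary scale (\<odot>) r"
  shows "comult_id scale \<Delta> (\<Delta> x) - id_comult scale \<Delta> (\<Delta> x)
       = twist_id (comult_id scale \<Delta> (\<Delta> x) - id_comult scale \<Delta> (\<Delta> x))"
proof
  fix w :: "'a \<Rightarrow> 'a \<Rightarrow> 'a \<Rightarrow> 'k"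
  let ?w = "\<lambda>u v z. w v u z"
  have flip: "trilinear_form scale ?w \<longleftrightarrow> trilinear_form scale w"
    unfolding trilinear_form_def trilinear_map_def by blast
  show "(comult_id scale \<Delta> (\<Delta> x) - id_comult scale \<Delta> (\<Delta> x)) w
    = twist_id (comult_id scale \<Delta> (\<Delta> x) - id_comult scale \<Delta> (\<Delta> x)) w"
  proof (cases "trilinear_form scale w")
    case w: True
    note ws = trilinear_simps[OF w]
    have w': "trilinear_form scale ?w"
      using w flip by simp
    have w1: "trilinear_form scale (\<lambda>u v z. w (x \<odot> u) v z)"
      and w2: "trilinear_form scale (\<lambda>u v z. w u (x \<odot> v) z)"
      and w3: "trilinear_form scale (\<lambda>u v z. w u v (x \<odot> z - z \<odot> x))"
      by (rule trilinear_formI; simp add: ws algebra_simps)+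
    \<comment> \<open>The coassociator minus its twist is \<open>-(L\<^sub>x \<otimes> id \<otimes> id + id \<otimes> L\<^sub>x \<otimes> id + id \<otimes> id \<otimes> (L\<^sub>x - R\<^sub>x))\<close>
      applied to the Yang-Baxter expression; what is left over in the three tensor slots
      vanishes by the pre-Lie identity (slots 1, 2) and the Jacobi identity (slot 3).\<close>
    define E F G C
      where "E w p p' q q' = w ((x \<odot> q) \<odot> p) p' q' + w (q \<odot> p) p' (x \<odot> q' - q' \<odot> x)
        + (w p' ((x \<odot> q) \<odot> p - p \<odot> (x \<odot> q)) q' + w p' (q \<odot> p - p \<odot> q) (x \<odot> q' - q' \<odot> x))"
      and "F w p p' q q' = w (x \<odot> p') (p \<odot> q) q' + w p' ((x \<odot> p - p \<odot> x) \<odot> q) q'"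
      and "G w p p' q q' = w (x \<odot> p') q' (p \<odot> q - q \<odot> p)
        + w p' q' ((x \<odot> p - p \<odot> x) \<odot> q - q \<odot> (x \<odot> p - p \<odot> x))"
      and "C w p p' q q' = w p' (p \<odot> q) q' + w p' q' (p \<odot> q - q \<odot> p) - w (p \<odot> q) p' q'"
    for w :: "'a \<Rightarrow> 'a \<Rightarrow> 'a \<Rightarrow> 'k" and p p' q q'
    note defs = this
    let ?T = "pair_sum n a b"
    have coassoc: "(comult_id scale \<Delta> (\<Delta> x) - id_comult scale \<Delta> (\<Delta> x)) w
        = ?T (E w) - (?T (F w) + ?T (G w))" if "trilinear_form scale w" for w
      using that
      by (simp only: minus_apply \<Delta>_def comult_id_coboundary id_comult_coboundary defs[abs_def])
    have C: "?T (C w) = 0" if "trilinear_form scale w" for w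
      using cybe_pair_sum[OF that] by (simp only: defs[abs_def])
    let ?w1 = "\<lambda>u v z. w (x \<odot> u) v z" and ?w2 = "\<lambda>u v z. w u (x \<odot> v) z"
      and ?w3 = "\<lambda>u v z. w u v (x \<odot> z - z \<odot> x)"
    have "E w p p' q q' - (F w p p' q q' + G w p p' q q')
        - (E ?w p p' q q' - (F ?w p p' q q' + G ?w q q' p p'))
        + (C ?w1 p p' q q' + C ?w2 p p' q q' + C ?w3 p p' q q') = 0" for p p' q q'
    proof -
      have *: "x \<odot> (p \<odot> q) = (x \<odot> p) \<odot> q - (p \<odot> x) \<odot> q + p \<odot> (x \<odot> q)"
        "x \<odot> (q \<odot> p) = (x \<odot> q) \<odot> p - (q \<odot> x) \<odot> p + q \<odot> (x \<odot> p)"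
        "p \<odot> (q \<odot> x) = (p \<odot> q) \<odot> x - (q \<odot> p) \<odot> x + q \<odot> (p \<odot> x)"
        using pre_lie[of x p q] pre_lie[of x q p] pre_lie[of p q x] by (simp_all add: algebra_simps)
      show ?thesis
        by (simp add: defs ws *)
    qed
    then have "?T (\<lambda>p p' q q'. E w p p' q q' - (F w p p' q q' + G w p p' q q')
        - (E ?w p p' q q' - (F ?w p p' q q' + G ?w q q' p p'))
        + (C ?w1 p p' q q' + C ?w2 p p' q q' + C ?w3 p p' q q')) = 0"
      by (simp only: pair_sum_def sum.neutral_const)
    then have "?T (E w) - (?T (F w) + ?T (G w)) = ?T (E ?w) - (?T (F ?w) + ?T (G ?w))"
      unfolding pair_sum_exchange[of n a b "G ?w"]
      by (simp only: pair_sum_add pair_sum_diff C[OF w1] C[OF w2] C[OF w3]) simp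
    then show ?thesis
      by (simp only: twist_id_def coassoc[OF w] coassoc[OF w'])
  qed (simp add: twist_id_def comult_id_def id_comult_def flip)
qed

end
end
end

section \<open>Compatibility with the averaging operators\<close>

context admissible_averaging_pre_lie_algebra
begin

lemma S_L: "S \<circ> L x \<circ> P = L (S x) \<circ> P" "S \<circ> L (S x) = L (S x) \<circ> P"
  "S \<circ> L (P x) = L (P x) \<circ> S" "S \<circ> L x \<circ> S = L (P x) \<circ> S"
  and S_R: "S \<circ> R x \<circ> P = R (S x) \<circ> P" "S \<circ> R (S x) = R (S x) \<circ> P"
  "S \<circ> R (P x) = R (P x) \<circ> S" "S \<circ> R x \<circ> S = R (P x) \<circ> S"
  and P_L: "P \<circ> L x \<circ> P = L (P x) \<circ> P" "P \<circ> L (P x) = L (P x) \<circ> P"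
  and P_R: "P \<circ> R x \<circ> P = R (P x) \<circ> P" "P \<circ> R (P x) = R (P x) \<circ> P"
  using averaging_left averaging_right admissible_PS admissible_SP
  by (simp_all add: fun_eq_iff lmult_def rmult_def)

lemma S_ad: "S \<circ> ad x \<circ> P = ad (S x) \<circ> P" "S \<circ> ad (S x) = ad (S x) \<circ> P"
  "S \<circ> ad (P x) = ad (P x) \<circ> S" "S \<circ> ad x \<circ> S = ad (P x) \<circ> S"
  and P_ad: "P \<circ> ad x \<circ> P = ad (P x) \<circ> P" "P \<circ> ad (P x) = ad (P x) \<circ> P"
  by (simp_all only: comp_diff_linear[OF linear_S] comp_diff_linear[OF linear_P] diff_comp_map
      S_L S_R P_L P_R)

context
  fixes r
  assumes r: "r \<in> tensor_square scale"
    and slide_S: "tensor_map scale S id r = tensor_map scale id P r"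
    and slide_P: "tensor_map scale P id r = tensor_map scale id S r"
begin

lemma slide:
  assumes "Vector_Spaces.linear scale scale f"
  shows "tensor_map scale f S r = tensor_map scale (f \<circ> P) id r"
    and "tensor_map scale S f r = tensor_map scale id (f \<circ> P) r"
    and "tensor_map scale f P r = tensor_map scale (f \<circ> S) id r"
    and "tensor_map scale P f r = tensor_map scale id (f \<circ> S) r"
  using arg_cong[OF slide_P, of "tensor_map scale f id"]
    arg_cong[OF slide_P, of "tensor_map scale id f"]
    arg_cong[OF slide_S, of "tensor_map scale f id"]
    arg_cong[OF slide_S, of "tensor_map scale id f"]
  by (simp_all add: tensor_map_compose assms)

lemma tensor_map_coboundary:
  assumes "Vector_Spaces.linear scale scale f" "Vector_Spaces.linear scale scale g"
  shows "tensor_map scale f g (coboundary scale (\<odot>) r x)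
    = tensor_map scale (f \<circ> L x) g r + tensor_map scale f (g \<circ> ad x) r"
  by (simp only: coboundary_eq tensor_map_add tensor_map_compose assms comp_id)

lemmas averaging_rules =
  tensor_map_coboundary slide linear_P linear_S linear_endomorphisms linear_comp
  S_L S_ad P_L P_ad id_comp comp_id

lemma averaging_pre_lie_bialgebra_coboundary:
  assumes sym: "symmetric_tensor r"
    and r_eq: "r = (\<Sum>i<(n::nat). a i \<otimes>\<^bsub>scale\<^esub> b i)"
    and cybe: "(\<Sum>i<n. \<Sum>j<n. triple_tensor scale (a i) (b i \<odot> a j) (b j)
                     + triple_tensor scale (a i) (a j) (b i \<odot> b j))
        = (\<Sum>i<n. \<Sum>j<n. triple_tensor scale (a i \<odot> a j) (b i) (b j)
                     + triple_tensor scale (a i) (a j) (b j \<odot> b i))"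
  shows "averaging_pre_lie_bialgebra scale (\<odot>) (coboundary scale (\<odot>) r) P S"
proof -
  let ?\<Delta> = "coboundary scale (\<odot>) r"
  interpret \<Delta>: Vector_Spaces.linear scale tensor_scale ?\<Delta>
    by (rule linear_coboundary[OF r])
  interpret S: Vector_Spaces.linear scale scale S
    by (rule linear_S)
  show ?thesis
  proof unfold_locales
    fix x y
    show "?\<Delta> x \<in> tensor_square scale"
      by (rule coboundary_tensor_square[OF r])
    show "comult_id scale ?\<Delta> (?\<Delta> x) - id_comult scale ?\<Delta> (?\<Delta> x)
        = twist_id (comult_id scale ?\<Delta> (?\<Delta> x) - id_comult scale ?\<Delta> (?\<Delta> x))"
      by (rule pre_lie_coboundary[OF r_eq sym cybe])
    show "?\<Delta> (x \<odot> y - y \<odot> x) = (tensor_map scale (L x) id + tensor_map scale id (ad x)) (?\<Delta> y)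
        - (tensor_map scale (L y) id + tensor_map scale id (ad y)) (?\<Delta> x)"
      by (rule coboundary_commutator[OF r])
    show "(id - twist) (?\<Delta> (x \<odot> y)) = (id - twist) (tensor_map scale id (R y) (?\<Delta> x)
        + (tensor_map scale (L x) id + tensor_map scale id (L x)) (?\<Delta> y))"
      by (rule coboundary_circ[OF r sym])
  qed (simp_all only: averaging_rules)
qed

end
end

theorem theorem4p6:
  fixes scale :: "'k::field_char_0 \<Rightarrow> 'a::ab_group_add \<Rightarrow> 'a"
    and Basis :: "'a set"
    and circ :: "'a \<Rightarrow> 'a \<Rightarrow> 'a"
    and P S :: "'a \<Rightarrow> 'a"
    and r :: "('a, 'k) tensor2"
  assumes "finite_dimensional_vector_space scale Basis"
    and "admissible_averaging_pre_lie_algebra scale circ P S"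
    and "r \<in> tensor_square scale"
    and "symmetric_tensor r"
    and "admissible_cybe_solution scale circ P S r"
  shows "averaging_pre_lie_bialgebra scale circ (coboundary scale circ r) P S"
  using assms(3-5)
    admissible_averaging_pre_lie_algebra.averaging_pre_lie_bialgebra_coboundary[OF assms(2), of r]
  by (auto simp: admissible_cybe_solution_def)

end
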